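(* Let $\Gamma$ be a $PT$-graph of type 2(c), in which the two cycles of $\Gamma_P$ have lengths $p$ and $q$, the vertices $u_1,u_2$ belong to the $p$-cycle and the vertices $v_1,v_2$ belong to the $q$-cycle. Then a $(0,1,-1)$-matrix corresponding to $\Gamma$ has finite multiplicative order if and only if at least one of $d_P(u_1,u_2)$ and $d_P(v_1,v_2)$ is a multiple of $\gcd(p,q)$.
   Context: A $PT$-graph of type 2(c) is a 2-arc-coloured digraph whose arcs are: blue arcs $\Gamma_P$ forming two vertex-disjoint directed cycles, of lengths $p$ and $q$, covering all vertices; and four further arcs, red arcs $(u_1,v_1)$, $(u_2,v_2)$ and blue arcs $(u_1,v_2)$, $(u_2,v_1)$, where $u_1,u_2$ are distinct vertices of the $p$-cycle and $v_1,v_2$ are distinct vertices of the $q$-cycle. Given an ordering $w_1,\dots,w_n$ of the vertices, the corresponding $(0,1,-1)$-matrix $A$ has $A_{ij}=1$ if $(w_i,w_j)$ is a blue arc, $-1$ if it is a red arc, $0$ otherwise. $d_P(u,v)$ denotes the length of the directed path from $u$ to $v$ along the cycle of $\Gamma_P$ containing both. *)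

theory Defs
  imports "Jordan_Normal_Form.Matrix" "Graph_Theory.Arc_Walk" "Graph_Theory.Pair_Digraph"
begin

datatype arc_colour = Blue | Red

(* A 2-arc-coloured digraph is a digraph G together with a colouring c of its arcs; only the
   values of c on parcs G matter. *)

definition cycle_verts :: "('a \<times> 'a) awalk \<Rightarrow> 'a set" where
  "cycle_verts C = fst ` set C"

(* P is Gamma_P, as a digraph on all vertices; Cp and Cq are its two directed cycles, given as
   cyclic sequences of arcs. Distinctness of u1, u2 (and of v1, v2) forces p, q >= 2, and the
   four further arcs run between the two cycles, so they are automatically not arcs of P. *)
definition PT_graph_2c ::
  "'a pair_pre_digraph \<Rightarrow> ('a \<times> 'a \<Rightarrow> arc_colour) \<Rightarrow> 'a pair_pre_digraph \<Rightarrow>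
   nat \<Rightarrow> nat \<Rightarrow> 'a \<Rightarrow> 'a \<Rightarrow> 'a \<Rightarrow> 'a \<Rightarrow> bool" where
  "PT_graph_2c G c P p q u1 u2 v1 v2 \<longleftrightarrow>
     (\<exists>Cp Cq.
        pverts P = pverts G \<and>
        pre_digraph.cycle (with_proj P) Cp \<and> length Cp = p \<and>
        pre_digraph.cycle (with_proj P) Cq \<and> length Cq = q \<and>
        parcs P = set Cp \<union> set Cq \<and>
        pverts P = cycle_verts Cp \<union> cycle_verts Cq \<and>
        cycle_verts Cp \<inter> cycle_verts Cq = {} \<and>
        u1 \<in> cycle_verts Cp \<and> u2 \<in> cycle_verts Cp \<and> u1 \<noteq> u2 \<and>
        v1 \<in> cycle_verts Cq \<and> v2 \<in> cycle_verts Cq \<and> v1 \<noteq> v2) \<and>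
     parcs G = parcs P \<union> {(u1, v1), (u2, v2), (u1, v2), (u2, v1)} \<and>
     (\<forall>e \<in> parcs P. c e = Blue) \<and>
     c (u1, v1) = Red \<and> c (u2, v2) = Red \<and> c (u1, v2) = Blue \<and> c (u2, v1) = Blue"

(* The path from u to v in P is unique when u and v lie on the same cycle of P, which is the only
   case in which this is used. *)
definition path_dist :: "'a pair_pre_digraph \<Rightarrow> 'a \<Rightarrow> 'a \<Rightarrow> nat" where
  "path_dist P u v = (THE k. \<exists>w. pre_digraph.apath (with_proj P) u w v \<and> length w = k)"

definition vertex_ordering :: "'a pair_pre_digraph \<Rightarrow> 'a list \<Rightarrow> bool" where
  "vertex_ordering G ws \<longleftrightarrow> distinct ws \<and> set ws = pverts G"

definition signed_matrix ::
  "'a pair_pre_digraph \<Rightarrow> ('a \<times> 'a \<Rightarrow> arc_colour) \<Rightarrow> 'a list \<Rightarrow> int mat" where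
  "signed_matrix G c ws =
     mat (length ws) (length ws)
       (\<lambda>(i, j). if (ws ! i, ws ! j) \<in> parcs G
                 then (case c (ws ! i, ws ! j) of Blue \<Rightarrow> 1 | Red \<Rightarrow> - 1) else 0)"

definition finite_mult_order :: "'a::semiring_1 mat \<Rightarrow> bool" where
  "finite_mult_order A \<longleftrightarrow> (\<exists>k>0. A ^\<^sub>m k = 1\<^sub>m (dim_row A))"

end

theory Submission
  imports Defs
begin

text \<open>
  Listing the vertices of the first cycle before those of the second makes the matrix block upper
  triangular, with two cyclic permutation matrices on the diagonal. Its power with exponent
  \<open>lcm p q\<close> is therefore unipotent, with an off-diagonal block \<open>S\<close>, and the order is finite iff
  \<open>S = 0\<close>. The walks counted in an entry of \<open>S\<close> follow the first cycle, cross one of the four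
  further arcs, and follow the second cycle. By the Chinese remainder theorem each crossing arc
  contributes to an entry exactly one signed walk or none, according to a congruence modulo
  \<open>gcd p q\<close> on the difference of the positions of its two ends. So \<open>S = 0\<close> iff the two red and the
  two blue crossing arcs realise the same residues, that is iff the positions of \<open>u1\<close>, \<open>u2\<close> or those
  of \<open>v1\<close>, \<open>v2\<close> agree modulo \<open>gcd p q\<close>.
\<close>

section \<open>Simultaneous congruences modulo two periods\<close>

text \<open>The sum counts the \<open>i\<close> in one period that are congruent to
  \<open>- r\<close> modulo \<open>p\<close> and to \<open>- s\<close> modulo \<open>q\<close>. By
  the Chinese remainder theorem for moduli that need not be coprime, these form a single class
  modulo \<open>lcm p q\<close>, or none when \<open>r\<close> and \<open>s\<close> differ modulo
  the gcd.\<close>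

lemma sum_two_dvd_block:
  fixes p q :: nat and r s :: int
  assumes "p > 0" "q > 0"
  shows "(\<Sum>i<lcm p q. of_bool (int p dvd r + int i) * of_bool (int q dvd s + int i) :: int)
           = of_bool (int (gcd p q) dvd r - s)"
proof -
  let ?L = "lcm p q"
  let ?S = "{i \<in> {..<?L}. int p dvd r + int i \<and> int q dvd s + int i}"
  have Lpos: "?L > 0" using assms by (simp add: lcm_pos_nat)
  have *: "(\<Sum>i<?L. of_bool (int p dvd r + int i) * of_bool (int q dvd s + int i) :: int) = int (card ?S)"
    by (subst of_bool_conj[symmetric], subst sum_of_bool_eq) (auto intro!: arg_cong[where f = card])
  show ?thesis
  proof (cases "int (gcd p q) dvd r - s")
    case True
    then obtain k where k: "r - s = int (gcd p q) * k" by blast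
    obtain x y where xy: "x * int p + y * int q = int (gcd p q)"
      using bezout_int[of "int p" "int q"] by auto
    \<comment> \<open>This \<open>j\<close> is \<open>- r\<close> modulo \<open>p\<close> by
      construction; replacing \<open>r - s\<close> by \<open>(x * p + y * q) * k\<close> turns
      \<open>s + j\<close> into a multiple of \<open>q\<close>. It is then reduced into the range of
      summation.\<close>
    define j where "j = - r + int p * x * k"
    have j1: "int p dvd r + j" by (simp add: j_def)
    have "s + j = - int q * (y * k)"
      using k unfolding xy[symmetric] j_def by (simp add: algebra_simps)
    then have j2: "int q dvd s + j" by simp
    define i where "i = nat (j mod int ?L)"
    have ii: "int i = j mod int ?L" using Lpos by (simp add: i_def)
    then have dL: "int ?L dvd int i - j" by (simp add: mod_eq_dvd_iff[symmetric])
    have dp: "int p dvd int i - j" using dL by (meson dvd_lcm1 dvd_trans int_dvd_int_iff)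
    have dq: "int q dvd int i - j" using dL by (meson dvd_lcm2 dvd_trans int_dvd_int_iff)
    have "int p dvd r + int i" using dvd_add[OF j1 dp] by simp
    moreover have "int q dvd s + int i" using dvd_add[OF j2 dq] by simp
    moreover have iL: "i < ?L" using Lpos ii by (metis of_nat_0_less_iff of_nat_less_iff pos_mod_bound)
    ultimately have iS: "i \<in> ?S" by simp
    have "i' = i" if "i' \<in> ?S" for i'
    proof -
      have "int p dvd (r + int i') - (r + int i)" "int q dvd (s + int i') - (s + int i)"
        using that iS by (blast intro: dvd_diff)+
      then have "int ?L dvd int i' - int i"
        by (simp add: lcm_least flip: lcm_int_int_eq)
      then have "int i' mod int ?L = int i mod int ?L" by (simp add: mod_eq_dvd_iff)
      then show ?thesis using that iL by simp
    qed
    then have "?S = {i}" using iS by blast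
    then show ?thesis using * True by simp
  next
    case False
    have "?S = {}"
    proof (rule ccontr)
      assume "?S \<noteq> {}"
      then obtain i where "int p dvd r + int i" "int q dvd s + int i" by blast
      then have "int (gcd p q) dvd (r + int i) - (s + int i)"
        by (meson dvd_diff dvd_trans gcd_dvd1 gcd_dvd2 int_dvd_int_iff)
      then show False using False by simp
    qed
    then show ?thesis using * False by simp
  qed
qed

lemma sum_lessThan_add:
  fixes f :: "nat \<Rightarrow> 'a :: comm_monoid_add"
  shows "sum f {..<m + n} = sum f {..<m} + (\<Sum>i<n. f (m + i))"
  by (induction n) (simp_all add: add.assoc)

text \<open>Both indicators have period \<open>lcm p q\<close>, so \<open>t\<close> periods repeat
  the one-period count. The general \<open>t\<close> is needed because the exponent of a finite
  order is not known beforehand.\<close>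

lemma sum_two_dvd:
  fixes p q :: nat and r s :: int
  assumes "p > 0" "q > 0"
  shows "(\<Sum>i<lcm p q * t. of_bool (int p dvd r + int i) * of_bool (int q dvd s + int i) :: int)
           = int t * of_bool (int (gcd p q) dvd r - s)"
proof (induction t)
  case (Suc t)
  let ?f = "\<lambda>i::nat. of_bool (int p dvd r + int i) * of_bool (int q dvd s + int i) :: int"
  let ?L = "lcm p q"
  have per: "?f (?L * t + i) = ?f i" for i
  proof -
    have "int p dvd int (?L * t)" "int q dvd int (?L * t)"
      unfolding int_dvd_int_iff by (simp_all add: dvd_mult2)
    then have "int p dvd (r + int i) + int (?L * t) \<longleftrightarrow> int p dvd r + int i"
      "int q dvd (s + int i) + int (?L * t) \<longleftrightarrow> int q dvd s + int i"
      by (simp_all only: dvd_add_left_iff)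
    then show ?thesis by (simp add: algebra_simps)
  qed
  have "sum ?f {..<?L * Suc t} = sum ?f {..<?L * t + ?L}" by (simp add: add.commute)
  also have "\<dots> = sum ?f {..<?L * t} + (\<Sum>i<?L. ?f (?L * t + i))"
    by (simp only: sum_lessThan_add)
  also have "\<dots> = sum ?f {..<?L * t} + sum ?f {..<?L}" by (simp only: per)
  finally show ?case using Suc sum_two_dvd_block[OF assms] by (simp add: algebra_simps)
qed simp

section \<open>Matrix powers indexed by vertices\<close>

text \<open>Matrix power with rows and columns indexed by vertices instead of positions, which frees
  the computation from the chosen ordering. The recursion splits off the last step of a
  walk.\<close>

fun kernel_pow :: "'a set \<Rightarrow> ('a \<Rightarrow> 'a \<Rightarrow> int) \<Rightarrow> nat \<Rightarrow> 'a \<Rightarrow> 'a \<Rightarrow> int" where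
  "kernel_pow V F 0 x y = of_bool (x = y)"
| "kernel_pow V F (Suc k) x y = (\<Sum>z\<in>V. kernel_pow V F k x z * F z y)"

lemma pow_mat_kernel:
  assumes "distinct ws"
  shows "mat (length ws) (length ws) (\<lambda>(i, j). F (ws ! i) (ws ! j)) ^\<^sub>m k
           = mat (length ws) (length ws) (\<lambda>(i, j). kernel_pow (set ws) F k (ws ! i) (ws ! j))"
proof (induction k)
  case 0
  then show ?case using assms by (auto intro!: eq_matI simp: nth_eq_iff_index_eq)
next
  case (Suc k)
  have "(\<Sum>l = 0..<length ws. g (ws ! l)) = (\<Sum>z\<in>set ws. g z)" for g :: "'a \<Rightarrow> int"
    using sum.reindex_bij_betw[OF bij_betw_nth[OF assms, of "{0..<length ws}" "set ws"]]
    by (simp add: atLeast0LessThan)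
  then show ?case by (auto intro!: eq_matI simp: Suc.IH scalar_prod_def)
qed

lemma one_mat_kernel:
  assumes "distinct ws"
  shows "mat (length ws) (length ws) (\<lambda>(i, j). E (ws ! i) (ws ! j)) = 1\<^sub>m (length ws)
           \<longleftrightarrow> (\<forall>x\<in>set ws. \<forall>y\<in>set ws. E x y = of_bool (x = y))" (is "?M = _ \<longleftrightarrow> ?R")
proof
  assume M: "?M = 1\<^sub>m (length ws)"
  show ?R
  proof (intro ballI)
    fix x y assume "x \<in> set ws" "y \<in> set ws"
    then obtain i j where ij: "i < length ws" "j < length ws" "x = ws ! i" "y = ws ! j"
      by (metis in_set_conv_nth)
    then have "?M $$ (i, j) = 1\<^sub>m (length ws) $$ (i, j)" by (simp only: M)
    then show "E x y = of_bool (x = y)" using ij assms by (simp add: nth_eq_iff_index_eq)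
  qed
next
  assume ?R
  then show "?M = 1\<^sub>m (length ws)"
    using assms by (auto intro!: eq_matI simp: nth_eq_iff_index_eq)
qed

text \<open>Lets an arbitrary exponent be replaced by a multiple of \<open>lcm p q\<close>, where
  the entries have a closed form.\<close>

lemma pow_mat_mult_eq_one:
  fixes A :: "'a :: semiring_1 mat"
  assumes "A \<in> carrier_mat n n" "A ^\<^sub>m k = 1\<^sub>m n"
  shows "A ^\<^sub>m (k * t) = 1\<^sub>m n"
proof (induction t)
  case (Suc t)
  have "A ^\<^sub>m (i + j) = A ^\<^sub>m i * A ^\<^sub>m j" for i j
    using assms(1)
    by (induction j) (simp_all add: assoc_mult_mat[of _ n n _ n _ n] right_mult_one_mat[of _ n n])
  then have "A ^\<^sub>m (k * Suc t) = A ^\<^sub>m (k * t) * A ^\<^sub>m k"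
    by (metis add.commute mult_Suc_right)
  then show ?case using Suc assms by simp
qed (use assms in auto)

section \<open>Directed cycles and distances along them\<close>

text \<open>Both lists are the vertex sequence of the walk; comparing entries shows that each head
  is the next tail.\<close>

lemma pcas_shift: "pcas u es v \<Longrightarrow> map fst es @ [v] = u # map snd es"
  by (induction es arbitrary: u) auto

lemma pawalk_verts_eq: "pcas u es v \<Longrightarrow> pawalk_verts u es = u # map snd es"
  by (induction es arbitrary: u) auto

text \<open>Indexing by all integers, with the length as period, removes wrap-around cases: the
  successor is always \<open>m + 1\<close>, and equality of vertices is a congruence.\<close>

lemma cycle_parametrisation:
  assumes "pre_digraph.cycle (with_proj P) C"
  obtains a :: "int \<Rightarrow> 'a" where "length C > 0"
    "\<And>m n. a m = a n \<longleftrightarrow> int (length C) dvd m - n"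
    "set C = range (\<lambda>m. (a m, a (m + 1)))" "cycle_verts C = range a"
proof -
  let ?L = "length C"
  obtain u where C: "pcas u C u" "distinct (tl (pawalk_verts u C))" "C \<noteq> []"
    using assms unfolding pre_digraph.cycle_def pre_digraph.awalk_def cas_with_proj_eq
      awalk_verts_with_proj_eq by blast
  note sh = pcas_shift[OF C(1)]
  have ds: "distinct (map snd C)" using C pawalk_verts_eq[OF C(1)] by simp
  \<comment> \<open>A cycle provides distinct heads. As the walk is closed, tails and heads form the
    same multiset, so the tails are distinct too.\<close>
  have "mset (map fst C @ [u]) = mset (u # map snd C)" by (simp only: sh)
  then have "mset (map fst C) = mset (map snd C)" by simp
  then have df: "distinct (map fst C)" using ds mset_eq_imp_distinct_iff by blast
  have L0: "?L > 0" using C by simp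
  define a where "a m = fst (C ! nat (m mod int ?L))" for m
  have idx: "nat (m mod int ?L) < ?L" for m
    using L0 by (simp add: nat_less_iff)
  have eq: "a m = a n \<longleftrightarrow> int ?L dvd m - n" for m n
  proof -
    have "a m = a n \<longleftrightarrow> nat (m mod int ?L) = nat (n mod int ?L)"
      using nth_eq_iff_index_eq[OF df, of "nat (m mod int ?L)" "nat (n mod int ?L)"] idx
      by (simp add: a_def)
    also have "\<dots> \<longleftrightarrow> m mod int ?L = n mod int ?L"
      using L0 by (simp add: nat_eq_iff)
    finally show ?thesis by (simp add: mod_eq_dvd_iff)
  qed
  have an: "a (int i) = fst (C ! i)" if "i < ?L" for i
    using that by (simp add: a_def flip: zmod_int)
  have nx: "snd (C ! i) = a (int i + 1)" if "i < ?L" for i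
  proof -
    have "(map fst C @ [u]) ! Suc i = snd (C ! i)" using sh that by simp
    moreover have "(map fst C @ [u]) ! Suc i = a (int i + 1)"
    proof (cases "Suc i < ?L")
      case True
      then show ?thesis using an[of "Suc i"] by (simp add: nth_append add.commute)
    next
      \<comment> \<open>The last arc returns to the start \<open>u\<close>, which is
        \<open>a 0\<close> and, by periodicity, also \<open>a (int ?L)\<close>.\<close>
      case False
      then have "Suc i = ?L" using that by simp
      moreover have "u = a 0" using arg_cong[OF sh, of "\<lambda>l. l ! 0"] an[of 0] L0
        by (simp add: nth_append)
      moreover have "a 0 = a (int ?L)" by (simp add: eq)
      ultimately show ?thesis by (simp add: nth_append add.commute)
        (metis add.commute of_nat_Suc)
    qed
    ultimately show ?thesis by simp
  qed
  have Ci: "C ! i = (a (int i), a (int i + 1))" if "i < ?L" for i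
    using an[OF that] nx[OF that] by (simp add: prod_eq_iff)
  have arcs: "set C = range (\<lambda>m. (a m, a (m + 1)))"
  proof (intro equalityI subsetI)
    fix e assume "e \<in> set C"
    then obtain i where "i < ?L" "e = C ! i" by (auto simp: in_set_conv_nth)
    then show "e \<in> range (\<lambda>m. (a m, a (m + 1)))" using Ci by auto
  next
    fix e assume "e \<in> range (\<lambda>m. (a m, a (m + 1)))"
    then obtain m where m: "e = (a m, a (m + 1))" by blast
    let ?i = "nat (m mod int ?L)"
    have "int ?L dvd int ?i - m" using L0 by (simp add: mod_eq_dvd_iff[symmetric])
    then have "a (int ?i) = a m" "a (int ?i + 1) = a (m + 1)"
      unfolding eq by simp_all
    then have "e = C ! ?i" using m Ci[OF idx] by simp
    then show "e \<in> set C" using idx by simp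
  qed
  have "cycle_verts C = range a" by (simp add: cycle_verts_def arcs image_image)
  then show thesis using that L0 eq arcs by blast
qed

text \<open>With at most one arc out of each \<open>a m\<close>, a walk has no choices, so its start
  and length determine it.\<close>

lemma functional_walk:
  assumes "\<And>m y. (a m, y) \<in> R \<Longrightarrow> y = a (m + 1)"
    and "pcas (a m) w v" "set w \<subseteq> R"
  shows "v = a (m + int (length w)) \<and>
    pawalk_verts (a m) w = map (\<lambda>i. a (m + int i)) [0..<Suc (length w)]"
  using assms(2,3)
proof (induction w arbitrary: m)
  case (Cons e w)
  have e: "e = (a m, a (m + 1))" using Cons.prems assms(1)[of m "snd e"] by (cases e) auto
  with Cons have "v = a (m + 1 + int (length w))"
    "pawalk_verts (a (m + 1)) w = map (\<lambda>i. a (m + 1 + int i)) [0..<Suc (length w)]" by auto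
  moreover have "map (\<lambda>i. a (m + int i)) [0..<Suc (Suc k)]
      = a m # map (\<lambda>i. a (m + 1 + int i)) [0..<Suc k]" for k
    by (subst upt_conv_Cons, simp)
      (simp add: map_Suc_upt[symmetric] add.assoc del: upt_Suc)
  ultimately show ?case using e by (simp add: algebra_simps del: upt_Suc)
qed simp

lemma walk_exists:
  assumes "\<And>m. (a m, a (m + 1)) \<in> R"
  shows "\<exists>w. pcas (a m) w (a (m + int k)) \<and> set w \<subseteq> R \<and> length w = k"
proof (induction k arbitrary: m)
  case (Suc k)
  obtain w where "pcas (a (m + 1)) w (a (m + 1 + int k))" "set w \<subseteq> R" "length w = k"
    using Suc by blast
  then show ?case using assms by (intro exI[of _ "(a m, a (m + 1)) # w"]) (simp add: add.assoc)
qed simp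

text \<open>A walk of length \<open>j\<close> from \<open>a m\<close> ends at
  \<open>a (m + j)\<close> and is a path exactly when \<open>j < L\<close>. So the length of a path
  to \<open>a n\<close> is the one residue of \<open>n - m\<close> below \<open>L\<close>.\<close>

lemma path_dist_cycle:
  fixes a :: "int \<Rightarrow> 'a"
  assumes "L > 0" and eq: "\<And>m n. a m = a n \<longleftrightarrow> int L dvd m - n"
    and arc: "\<And>m y. (a m, y) \<in> parcs P \<longleftrightarrow> y = a (m + 1)"
    and "range a \<subseteq> pverts P"
  shows "path_dist P (a m) (a n) = nat ((n - m) mod int L)"
  unfolding path_dist_def
proof (rule the_equality)
  let ?k = "nat ((n - m) mod int L)"
  have k: "int ?k = (n - m) mod int L" "?k < L" using assms(1) by (simp_all add: nat_less_iff)
  have apath: "pre_digraph.apath (with_proj P) u w v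
     \<longleftrightarrow> u \<in> pverts P \<and> set w \<subseteq> parcs P \<and> pcas u w v \<and> distinct (pawalk_verts u w)" for u w v
    by (simp add: pre_digraph.apath_def pre_digraph.awalk_def cas_with_proj_eq
        awalk_verts_with_proj_eq)
  obtain w where w: "pcas (a m) w (a (m + int ?k))" "set w \<subseteq> parcs P" "length w = ?k"
    using walk_exists[of a "parcs P" m ?k] arc by auto
  \<comment> \<open>A walk of length \<open>j\<close> visits \<open>Suc j\<close> vertices, and the
    first repetition is index \<open>L\<close> meeting index 0; hence the bound is strict.\<close>
  have dist: "distinct (map (\<lambda>i. a (m + int i)) [0..<Suc j]) \<longleftrightarrow> j < L" for j
  proof
    assume "distinct (map (\<lambda>i. a (m + int i)) [0..<Suc j])"
    then have inj: "inj_on (\<lambda>i. a (m + int i)) {0..<Suc j}" by (simp add: distinct_map del: upt_Suc)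
    show "j < L"
    proof (rule ccontr)
      assume "\<not> j < L"
      moreover have "a (m + int L) = a (m + int 0)" by (simp add: eq)
      ultimately have "L = 0" using inj_onD[OF inj, of L 0] by simp
      then show False using assms(1) by simp
    qed
  next
    assume j: "j < L"
    have "inj_on (\<lambda>i. a (m + int i)) {0..<Suc j}"
    proof (rule inj_onI)
      fix x y assume xy: "x \<in> {0..<Suc j}" "y \<in> {0..<Suc j}" "a (m + int x) = a (m + int y)"
      then have "int x mod int L = int y mod int L" by (simp add: eq mod_eq_dvd_iff)
      then show "x = y" using xy j by simp
    qed
    then show "distinct (map (\<lambda>i. a (m + int i)) [0..<Suc j])" by (simp add: distinct_map del: upt_Suc)
  qed
  have "a (m + int ?k) = a n" unfolding eq k(1)
    by (metis add_diff_eq diff_diff_eq2 mod_eq_dvd_iff mod_mod_trivial add.commute)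
  moreover have "distinct (pawalk_verts (a m) w)"
    using functional_walk[of a "parcs P" m w, OF _ w(1,2)] arc dist[of ?k] k(2)
    by (simp add: w(3) del: upt_Suc)
  ultimately show "\<exists>w. pre_digraph.apath (with_proj P) (a m) w (a n) \<and> length w = ?k"
    using w assms(4) apath by (intro exI[of _ w]) auto
  fix j assume "\<exists>w. pre_digraph.apath (with_proj P) (a m) w (a n) \<and> length w = j"
  then obtain w where w: "set w \<subseteq> parcs P" "pcas (a m) w (a n)" "distinct (pawalk_verts (a m) w)"
    "length w = j" using apath by auto
  from functional_walk[of a "parcs P" m w, OF _ w(2,1)] arc
  have "a n = a (m + int j)" "j < L" using w(3,4) dist[of j] by (simp_all del: upt_Suc)
  then have "int j mod int L = (n - m) mod int L" unfolding eq
    by (metis mod_eq_dvd_iff diff_diff_eq dvd_diff_commute)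
  then show "j = ?k" using \<open>j < L\<close> by simp
qed

section \<open>Powers of the matrix of two linked cycles\<close>

text \<open>
  In the following locale \<open>u\<^sub>i = a \<alpha>i\<close> and \<open>v\<^sub>i = b \<beta>i\<close>; \<open>Fab\<close> uses that the crossing block of the
  matrix has rank one.
\<close>

locale two_cycles =
  fixes p q :: nat and a b :: "int \<Rightarrow> 'a" and F :: "'a \<Rightarrow> 'a \<Rightarrow> int" and \<alpha>1 \<alpha>2 \<beta>1 \<beta>2 :: int
  assumes pos: "p > 0" "q > 0"
    and a_eq: "\<And>m n. a m = a n \<longleftrightarrow> int p dvd m - n"
    and b_eq: "\<And>m n. b m = b n \<longleftrightarrow> int q dvd m - n"
    and ab: "\<And>m n. a m \<noteq> b n"
    and Faa: "\<And>m n. F (a m) (a n) = of_bool (a n = a (m + 1))"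
    and Fbb: "\<And>m n. F (b m) (b n) = of_bool (b n = b (m + 1))"
    and Fba: "\<And>m n. F (b m) (a n) = 0"
    and Fab: "\<And>m n. F (a m) (b n) =
       (of_bool (a m = a \<alpha>1) - of_bool (a m = a \<alpha>2)) * (of_bool (b n = b \<beta>2) - of_bool (b n = b \<beta>1))"
    and fin: "finite (range a)" "finite (range b)"
begin

abbreviation "V \<equiv> range a \<union> range b"

lemma sum_V: "(\<Sum>z\<in>V. h z) = sum h (range a) + sum h (range b)" for h :: "'a \<Rightarrow> int"
  using fin ab by (intro sum.union_disjoint) auto

lemma sum_a: "(\<Sum>z\<in>range a. of_bool (z = a m) * h z) = h (a m)" for h :: "'a \<Rightarrow> int"
  using fin by (subst sum.remove[of _ "a m"]) (auto intro!: sum.neutral)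

lemma sum_b: "(\<Sum>z\<in>range b. h z * of_bool (z = b m)) = h (b m)" for h :: "'a \<Rightarrow> int"
  using fin by (subst sum.remove[of _ "b m"]) (auto intro!: sum.neutral)

text \<open>No arc leads back to the first cycle, so a walk crosses at most once. If it crosses
  after \<open>i\<close> steps, it leaves from \<open>a (m + i)\<close>, and the remaining
  \<open>k - 1 - i\<close> steps end at \<open>b n\<close> only if it enters at
  \<open>b (n + 1 - k + i)\<close>.\<close>

lemma kernel_pow_blocks: "kernel_pow V F k (b m) (a n) = 0"
  "kernel_pow V F k (a m) (a n) = of_bool (a n = a (m + int k))"
  "kernel_pow V F k (b m) (b n) = of_bool (b n = b (m + int k))"
  "kernel_pow V F k (a m) (b n) = (\<Sum>i<k. F (a (m + int i)) (b (n + 1 - int k + int i)))"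
proof (induction k arbitrary: m n)
  case 0
  { case 1 then show ?case using ab by (metis kernel_pow.simps(1) of_bool_eq(1)) next
    case 2 then show ?case by auto next
    case 3 then show ?case by auto next
    case 4 then show ?case by (simp add: ab) }
next
  case (Suc k)
  have pow_a: "kernel_pow V F k (a m) z = of_bool (z = a (m + int k))" if "z \<in> range a" for z m
    using that by (auto simp: Suc)
  have F_b: "F z (b n) = of_bool (z = b (n - 1))" if "z \<in> range b" for z n
    using that by (auto simp: Fbb b_eq algebra_simps dvd_diff_commute)
  { case 1
    have "\<forall>z\<in>V. kernel_pow V F k (b m) z * F z (a n) = 0" by (auto simp: Suc Fba)
    then show ?case by (simp only: kernel_pow.simps) (rule sum.neutral) next
    case 2
    have "(\<Sum>z\<in>range a. kernel_pow V F k (a m) z * F z (a n)) = F (a (m + int k)) (a n)"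
      by (simp add: pow_a sum_a)
    moreover have "(\<Sum>z\<in>range b. kernel_pow V F k (a m) z * F z (a n)) = 0"
      by (auto simp: Fba intro!: sum.neutral)
    ultimately show ?case by (simp add: sum_V Faa add_ac) next
    case 3
    have "(\<Sum>z\<in>range b. kernel_pow V F k (b m) z * F z (b n)) = kernel_pow V F k (b m) (b (n - 1))"
      by (simp add: F_b sum_b)
    moreover have "(\<Sum>z\<in>range a. kernel_pow V F k (b m) z * F z (b n)) = 0"
      by (auto simp: Suc intro!: sum.neutral)
    ultimately show ?case by (simp add: sum_V Suc b_eq algebra_simps) next
    \<comment> \<open>The last step is either the crossing, which is the new summand
      \<open>i = k\<close>, or a step along the second cycle, where the induction hypothesis at
      \<open>n - 1\<close> gives the other summands.\<close>
    case 4
    have "(\<Sum>z\<in>range a. kernel_pow V F k (a m) z * F z (b n)) = F (a (m + int k)) (b n)"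
      by (simp add: pow_a sum_a)
    moreover have "(\<Sum>z\<in>range b. kernel_pow V F k (a m) z * F z (b n))
        = kernel_pow V F k (a m) (b (n - 1))"
      by (simp add: F_b sum_b)
    ultimately show ?case by (simp add: sum_V Suc add_ac) }
qed

text \<open>Expanding the product in \<open>Fab\<close> gives one term per crossing arc, positive
  for blue and negative for red, and \<open>sum_two_dvd\<close> evaluates each. The shift by the
  exponent drops out because \<open>q\<close> divides it; the \<open>+ 1\<close> accounts for the
  crossing step.\<close>

lemma kernel_pow_lcm_ab:
  "kernel_pow V F (lcm p q * t) (a m) (b n) = int t *
     (of_bool (int (gcd p q) dvd (m - \<alpha>1) - (n + 1 - \<beta>2))
    - of_bool (int (gcd p q) dvd (m - \<alpha>1) - (n + 1 - \<beta>1))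
    - of_bool (int (gcd p q) dvd (m - \<alpha>2) - (n + 1 - \<beta>2))
    + of_bool (int (gcd p q) dvd (m - \<alpha>2) - (n + 1 - \<beta>1)))"
proof -
  let ?k = "lcm p q * t"
  have b': "b (n + 1 - int ?k + int i) = b \<beta> \<longleftrightarrow> int q dvd (n + 1 - \<beta>) + int i" for i \<beta>
  proof -
    have "int q dvd int ?k" unfolding int_dvd_int_iff by (simp add: dvd_mult2)
    then have "int q dvd ((n + 1 - \<beta>) + int i) - int ?k \<longleftrightarrow> int q dvd (n + 1 - \<beta>) + int i"
      using dvd_diff_left_iff by blast
    then show ?thesis by (simp add: b_eq algebra_simps)
  qed
  have a': "a (m + int i) = a \<alpha> \<longleftrightarrow> int p dvd (m - \<alpha>) + int i" for i \<alpha>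
    by (simp add: a_eq algebra_simps)
  have factor: "c * x - c * y - (c * z - c * w) = c * (x - z - y + w)" for c x y z w :: int
    by (simp add: algebra_simps)
  have "kernel_pow V F ?k (a m) (b n) =
     (\<Sum>i<?k. (of_bool (int p dvd (m - \<alpha>1) + int i) - of_bool (int p dvd (m - \<alpha>2) + int i))
        * (of_bool (int q dvd (n + 1 - \<beta>2) + int i) - of_bool (int q dvd (n + 1 - \<beta>1) + int i)))"
    by (simp only: kernel_pow_blocks Fab a' b')
  also have "\<dots> = int t *
     (of_bool (int (gcd p q) dvd (m - \<alpha>1) - (n + 1 - \<beta>2))
    - of_bool (int (gcd p q) dvd (m - \<alpha>1) - (n + 1 - \<beta>1))
    - of_bool (int (gcd p q) dvd (m - \<alpha>2) - (n + 1 - \<beta>2))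
    + of_bool (int (gcd p q) dvd (m - \<alpha>2) - (n + 1 - \<beta>1)))"
    by (simp only: left_diff_distrib right_diff_distrib sum_subtractf sum_two_dvd[OF pos])
      (rule factor)
  finally show ?thesis .
qed

lemma kernel_pow_lcm_eq_one_iff:
  assumes "t > 0"
  shows "(\<forall>x\<in>V. \<forall>y\<in>V. kernel_pow V F (lcm p q * t) x y = of_bool (x = y)) \<longleftrightarrow>
     int (gcd p q) dvd \<alpha>2 - \<alpha>1 \<or> int (gcd p q) dvd \<beta>2 - \<beta>1" (is "?L \<longleftrightarrow> ?R")
proof
  let ?g = "int (gcd p q)"
  assume ?L
  \<comment> \<open>At this entry the red arc from \<open>u1\<close> to \<open>v1\<close>
    contributes \<open>- 1\<close> before scaling by \<open>t\<close>. Only a blue arc can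
    compensate: the one from \<open>u1\<close> requires \<open>?g dvd \<beta>2 - \<beta>1\<close>,
    the one from \<open>u2\<close> requires \<open>?g dvd \<alpha>1 - \<alpha>2\<close>.\<close>
  then have "kernel_pow V F (lcm p q * t) (a \<alpha>1) (b (\<beta>1 - 1)) = 0" using ab by simp
  then have "of_bool (?g dvd \<beta>2 - \<beta>1) - 1 - of_bool (?g dvd (\<alpha>1 - \<alpha>2) - (\<beta>1 - \<beta>2))
       + of_bool (?g dvd \<alpha>1 - \<alpha>2) = (0 :: int)"
    using assms by (simp add: kernel_pow_lcm_ab)
  then show ?R by (auto simp: dvd_diff_commute of_bool_def split: if_splits)
next
  let ?g = "int (gcd p q)"
  let ?k = "lcm p q * t"
  assume R: ?R
  have dk: "int p dvd int ?k" "int q dvd int ?k" unfolding int_dvd_int_iff by (simp_all add: dvd_mult2)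
  \<comment> \<open>Red and blue terms cancel in pairs: arcs with a common head if the tails agree
    modulo the gcd, arcs with a common tail if the heads do.\<close>
  have "kernel_pow V F ?k (a m) (b n) = 0" for m n
    using R
  proof
    assume g: "?g dvd \<alpha>2 - \<alpha>1"
    have "?g dvd (m - \<alpha>1) - x \<longleftrightarrow> ?g dvd (m - \<alpha>2) - x" for x
      using dvd_add_right_iff[OF g, of "(m - \<alpha>2) - x"] by (simp add: algebra_simps)
    then show ?thesis by (simp add: kernel_pow_lcm_ab)
  next
    assume g: "?g dvd \<beta>2 - \<beta>1"
    have "?g dvd x - (n + 1 - \<beta>2) \<longleftrightarrow> ?g dvd x - (n + 1 - \<beta>1)" for x
      using dvd_add_right_iff[OF g, of "x - (n + 1 - \<beta>1)"] by (simp add: algebra_simps)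
    then show ?thesis by (simp add: kernel_pow_lcm_ab)
  qed
  moreover have "a (m + int ?k) = a m" "b (m + int ?k) = b m" for m
    using dk by (simp_all add: a_eq b_eq)
  then have "kernel_pow V F ?k (a m) (a n) = of_bool (a m = a n)"
    "kernel_pow V F ?k (b m) (b n) = of_bool (b m = b n)" for m n
    using kernel_pow_blocks(2)[of ?k m n] kernel_pow_blocks(3)[of ?k m n]
    by (simp_all only: eq_commute[of "a n"] eq_commute[of "b n"])
  ultimately show ?L using ab ab[symmetric] kernel_pow_blocks(1)[of ?k]
    by (auto simp del: of_bool_eq_iff)
qed

text \<open>The criterion at exponent \<open>lcm p q * t\<close> does not depend on
  \<open>t\<close>. Hence any power equal to one forces it, and conversely it already makes the
  power at \<open>t = 1\<close> equal to one.\<close>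

lemma finite_mult_order_iff:
  assumes "distinct ws" "set ws = V"
  shows "finite_mult_order (mat (length ws) (length ws) (\<lambda>(i, j). F (ws ! i) (ws ! j))) \<longleftrightarrow>
    int (gcd p q) dvd \<alpha>2 - \<alpha>1 \<or> int (gcd p q) dvd \<beta>2 - \<beta>1" (is "finite_mult_order ?A \<longleftrightarrow> ?R")
proof -
  have A: "?A \<in> carrier_mat (length ws) (length ws)" by simp
  have pow: "?A ^\<^sub>m (lcm p q * t) = 1\<^sub>m (length ws) \<longleftrightarrow> ?R" if "t > 0" for t
    unfolding pow_mat_kernel[OF assms(1)] one_mat_kernel[OF assms(1)] assms(2)
    using kernel_pow_lcm_eq_one_iff[OF that] .
  show ?thesis
  proof
    assume "finite_mult_order ?A"
    then obtain k where "k > 0" "?A ^\<^sub>m k = 1\<^sub>m (length ws)"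
      by (auto simp: finite_mult_order_def)
    then show ?R using pow[of k] pow_mat_mult_eq_one[OF A, of k "lcm p q"] by (simp add: mult.commute)
  next
    assume ?R
    then have "?A ^\<^sub>m lcm p q = 1\<^sub>m (length ws)" using pow[of 1] by simp
    then show "finite_mult_order ?A" unfolding finite_mult_order_def
      using pos by (intro exI[of _ "lcm p q"]) (simp add: lcm_pos_nat)
  qed
qed

end

section \<open>From the graph to the two-cycle setting\<close>

theorem theorem4p6:
  fixes G P :: "'a pair_pre_digraph"
    and c :: "'a \<times> 'a \<Rightarrow> arc_colour"
    and p q :: nat
    and u1 u2 v1 v2 :: 'a
    and ws :: "'a list"
  assumes "PT_graph_2c G c P p q u1 u2 v1 v2"
    and "vertex_ordering G ws"
  shows "finite_mult_order (signed_matrix G c ws) \<longleftrightarrow>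
           gcd p q dvd path_dist P u1 u2 \<or> gcd p q dvd path_dist P v1 v2"
proof -
  obtain Cp Cq where
    V: "pverts P = pverts G" "pverts P = cycle_verts Cp \<union> cycle_verts Cq" and
    Cp: "pre_digraph.cycle (with_proj P) Cp" "length Cp = p" and
    Cq: "pre_digraph.cycle (with_proj P) Cq" "length Cq = q" and
    arcs: "parcs P = set Cp \<union> set Cq" and
    disj: "cycle_verts Cp \<inter> cycle_verts Cq = {}" and
    u: "u1 \<in> cycle_verts Cp" "u2 \<in> cycle_verts Cp" "u1 \<noteq> u2" and
    v: "v1 \<in> cycle_verts Cq" "v2 \<in> cycle_verts Cq" "v1 \<noteq> v2"
    using assms(1) unfolding PT_graph_2c_def by blast
  have G: "parcs G = parcs P \<union> {(u1, v1), (u2, v2), (u1, v2), (u2, v1)}"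
    and blue: "\<forall>e \<in> parcs P. c e = Blue"
    and col: "c (u1, v1) = Red" "c (u2, v2) = Red" "c (u1, v2) = Blue" "c (u2, v1) = Blue"
    using assms(1) unfolding PT_graph_2c_def by blast+
  obtain a where a: "p > 0" "\<And>m n. a m = a n \<longleftrightarrow> int p dvd m - n"
    "set Cp = range (\<lambda>m. (a m, a (m + 1)))" "cycle_verts Cp = range a"
    using cycle_parametrisation[OF Cp(1)] unfolding Cp(2) by blast
  obtain b where b: "q > 0" "\<And>m n. b m = b n \<longleftrightarrow> int q dvd m - n"
    "set Cq = range (\<lambda>m. (b m, b (m + 1)))" "cycle_verts Cq = range b"
    using cycle_parametrisation[OF Cq(1)] unfolding Cq(2) by blast
  have ab: "a m \<noteq> b n" "b n \<noteq> a m" for m n using disj a(4) b(4) by auto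
  \<comment> \<open>The parametrisations are not injective, so the successor must be shown
    independent of the chosen index.\<close>
  have a_suc: "a m = a k \<Longrightarrow> a (m + 1) = a (k + 1)" for m k by (simp add: a(2))
  have b_suc: "b m = b k \<Longrightarrow> b (m + 1) = b (k + 1)" for m k by (simp add: b(2))
  have arc_a: "(a m, y) \<in> parcs P \<longleftrightarrow> y = a (m + 1)" for m y
  proof -
    have "(a m, y) \<notin> set Cq" using ab by (auto simp: a(3) b(3))
    moreover have "(a m, y) \<in> set Cp \<longleftrightarrow> y = a (m + 1)"
      unfolding a(3) by (auto intro: a_suc[OF sym])
    ultimately show ?thesis by (simp add: arcs)
  qed
  have arc_b: "(b m, y) \<in> parcs P \<longleftrightarrow> y = b (m + 1)" for m y
  proof -
    have "(b m, y) \<notin> set Cp" using ab by (auto simp: a(3) b(3))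
    moreover have "(b m, y) \<in> set Cq \<longleftrightarrow> y = b (m + 1)"
      unfolding b(3) by (auto intro: b_suc[OF sym])
    ultimately show ?thesis by (simp add: arcs)
  qed
  obtain \<alpha>1 \<alpha>2 where \<alpha>: "u1 = a \<alpha>1" "u2 = a \<alpha>2" using u a(4) by auto
  obtain \<beta>1 \<beta>2 where \<beta>: "v1 = b \<beta>1" "v2 = b \<beta>2" using v b(4) by auto
  have du: "path_dist P u1 u2 = nat ((\<alpha>2 - \<alpha>1) mod int p)"
    unfolding \<alpha> using V a(4) by (intro path_dist_cycle a arc_a) auto
  have dv: "path_dist P v1 v2 = nat ((\<beta>2 - \<beta>1) mod int q)"
    unfolding \<beta> using V b(4) by (intro path_dist_cycle b arc_b) auto
  define F where "F x y = (if (x, y) \<in> parcs G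
      then (case c (x, y) of Blue \<Rightarrow> 1 | Red \<Rightarrow> - 1) else 0 :: int)" for x y
  interpret two_cycles p q a b F \<alpha>1 \<alpha>2 \<beta>1 \<beta>2
  proof
    show "finite (range a)" "finite (range b)"
      unfolding a(4)[symmetric] b(4)[symmetric] cycle_verts_def by simp_all
    show "F (a m) (a n) = of_bool (a n = a (m + 1))" for m n
      using blue ab by (auto simp: F_def G \<alpha> \<beta> arc_a)
    show "F (b m) (b n) = of_bool (b n = b (m + 1))" for m n
      using blue ab by (auto simp: F_def G \<alpha> \<beta> arc_b)
    show "F (b m) (a n) = 0" for m n
      using ab by (auto simp: F_def G \<alpha> \<beta> arc_b)
    \<comment> \<open>Since \<open>u1\<close>, \<open>u2\<close> and \<open>v1\<close>,
      \<open>v2\<close> are distinct, the four products have disjoint supports, with value 1 at the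
      blue and -1 at the red crossing arcs.\<close>
    show "F (a m) (b n) = (of_bool (a m = a \<alpha>1) - of_bool (a m = a \<alpha>2)) *
        (of_bool (b n = b \<beta>2) - of_bool (b n = b \<beta>1))" for m n
      using ab u(3) v(3) col unfolding \<alpha> \<beta> by (auto simp: F_def G \<alpha> \<beta> arc_a)
  qed (use a b ab in auto)
  have "signed_matrix G c ws = mat (length ws) (length ws) (\<lambda>(i, j). F (ws ! i) (ws ! j))"
    by (simp add: signed_matrix_def F_def)
  moreover have "distinct ws" "set ws = range a \<union> range b"
    using assms(2) V a(4) b(4) by (simp_all add: vertex_ordering_def)
  ultimately have "finite_mult_order (signed_matrix G c ws) \<longleftrightarrow>
      int (gcd p q) dvd \<alpha>2 - \<alpha>1 \<or> int (gcd p q) dvd \<beta>2 - \<beta>1"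
    by (simp only: finite_mult_order_iff)
  \<comment> \<open>Distances are index differences reduced modulo \<open>p\<close> or
    \<open>q\<close>; as the gcd divides both, the reduction preserves divisibility by it.\<close>
  moreover have dvd_nat: "g dvd nat (x mod int n) \<longleftrightarrow> int g dvd x" if "g dvd n" "n > 0" for g n x
  proof -
    have "g dvd nat (x mod int n) \<longleftrightarrow> int g dvd x mod int n" using that
      by (simp flip: int_dvd_int_iff)
    also have "\<dots> \<longleftrightarrow> int g dvd x" using that by (simp add: dvd_mod_iff)
    finally show ?thesis .
  qed
  ultimately show ?thesis using a(1) b(1) by (simp add: du dv)
qed

end
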